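(* Let $(\mathcal{X},d)$ be a metric space with finite diameter $\Delta := \sup_{x,x'\in\mathcal{X}} d(x,x') < \infty$, let $\mathcal{F}$ be a symmetric subset of the set $\mathrm{Lip}_1$ of $1$-Lipschitz real-valued functions on $\mathcal{X}$, let $P^*$ be a probability measure on $\mathcal{X}$, and let $S=(x_1,\dots,x_n)\in\mathcal{X}^n$ be an i.i.d. sample from $P^*$, with empirical distribution $P^*_n$. Let $\mathcal{G}$ be a set (of generators) such that each $g\in\mathcal{G}$ induces a probability measure $P^g$ on $\mathcal{X}$, let $\pi$ be a (prior) probability measure on $\mathcal{G}$, not depending on $S$, and let $\lambda>0$ and $\delta\in(0,1)$ be real numbers. Let $\mathcal{W}_{\mathcal{F}}(P^*_n,P^g)=\mathbb{E}_{S_g}[d_{\mathcal{F}}(P^*_n,P^g_n)]$ be the empirical risk of $g$. Then: (i) For any probability measure $\rho$ on $\mathcal{G}$ such that $\rho\ll\pi$ and $\pi\ll\rho$, with probability at least $1-\delta$ over the random draw of $S\sim (P^* )^{\otimes n}$, $$\mathbb{E}_{g\sim\rho}\,\mathbb{E}_{S}\big[\mathcal{W}_{\mathcal{F}}(P^*_n,P^g)\big]-\mathbb{E}_{g\sim\rho}\big[\mathcal{W}_{\mathcal{F}}(P^*_n,P^g)\big]\le \frac1\lambda\Big[\mathrm{KL}(\rho\,\|\,\pi)+\log\frac1\delta\Big]+\frac{\lambda\Delta^2}{4n}.$$ (ii) For any probability measure $\rho$ on $\mathcal{G}$ such that $\rho\ll\pi$ and $\pi\ll\rho$, with probability at least $1-\delta$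 over the random draw of $S\sim (P^* )^{\otimes n}$ and $g\sim\rho$, $$\mathbb{E}_{S}\big[\mathcal{W}_{\mathcal{F}}(P^*_n,P^g)\big]-\mathcal{W}_{\mathcal{F}}(P^*_n,P^g)\le \frac1\lambda\Big[\log\frac{d\rho}{d\pi}(g)+\log\frac1\delta\Big]+\frac{\lambda\Delta^2}{4n}.$$
   Context: A set $\mathcal{F}$ of real-valued functions is symmetric if $f\in\mathcal{F}$ implies $-f\in\mathcal{F}$. For probability measures $P,Q$ on $\mathcal{X}$, the integral probability metric induced by $\mathcal{F}$ is $d_{\mathcal{F}}(P,Q)=\sup_{f\in\mathcal{F}}\left|\int f\,dP-\int f\,dQ\right|$. The empirical distribution of $S=(x_1,\dots,x_n)$ is $P^*_n=\frac1n\sum_{i=1}^n\delta_{x_i}$. For $g\in\mathcal{G}$, $S_g=(\hat x_1,\dots,\hat x_n)\sim(P^g)^{\otimes n}$ is an i.i.d. sample of the same size $n$, independent of $S$, with empirical distribution $P^g_n=\frac1n\sum_{i=1}^n\delta_{\hat x_i}$. The empirical risk $\mathcal{W}_{\mathcal{F}}(P^*_n,P^g)=\mathbb{E}_{S_g}[d_{\mathcal{F}}(P^*_n,P^g_n)]$ is an expectation over $S_g$ only, hence a function of $S$ and $g$. $\mathbb{E}_S$ denotes expectation over $S\sim(P^* )^{\otimes n}$. $\mathrm{KL}(\rho\,\|\,\pi)=\mathbb{E}_{g\sim\rho}[\log\frac{d\rho}{d\pi}(g)]$ is the Kullback–Leibler divergence, $\ll$ denotes absolute continuity, and $\frac{d\rho}{d\pi}$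 is the Radon–Nikodym derivative. Convention: $\mathcal{G}$ carries a $\sigma$-algebra, and all quantities whose expectation or probability is taken are understood to be (jointly) measurable in $S$, $S_g$, $g$, with $g\mapsto P^g$ a Markov kernel. *)

theory Defs
  imports "HOL-Probability.Probability"
begin

definition symmetric_class :: "('a \<Rightarrow> real) set \<Rightarrow> bool" where
  "symmetric_class F \<longleftrightarrow> (\<forall>f\<in>F. (\<lambda>x. - f x) \<in> F)"

(* The supremum is taken in the reals. For 1-Lipschitz functions on a bounded space the values are
   bounded by the diameter; for empty F the value is a constant independent of P and Q. *)
definition ipm :: "('a \<Rightarrow> real) set \<Rightarrow> 'a measure \<Rightarrow> 'a measure \<Rightarrow> real" where
  "ipm F P Q = (SUP f\<in>F. \<bar>(\<integral>x. f x \<partial>P) - (\<integral>x. f x \<partial>Q)\<bar>)"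

(* Samples of size n are functions on {1..n}; emeasure (return borel x) is the Dirac mass at x. *)
definition empirical :: "nat \<Rightarrow> (nat \<Rightarrow> 'a::topological_space) \<Rightarrow> 'a measure" where
  "empirical n S = measure_of UNIV (sets borel)
     (\<lambda>A. ennreal (1 / real n) * (\<Sum>i\<in>{1..n}. emeasure (return borel (S i)) A))"

lemma sets_empirical [simp]: "sets (empirical n S) = sets borel"
  unfolding empirical_def
  by (metis sets.sets_measure_of_eq space_borel)

lemma emeasure_empirical:
  assumes "A \<in> sets borel"
  shows "emeasure (empirical n S) A
    = ennreal (1 / real n) * (\<Sum>i\<in>{1..n}. emeasure (return borel (S i)) A)"
proof (rule emeasure_measure_of[OF empirical_def])
  show "countably_additive (sets (empirical n S))
    (\<lambda>A. ennreal (1 / real n) * (\<Sum>i\<in>{1..n}. emeasure (return borel (S i)) A))"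
    unfolding countably_additive_def
  proof (intro allI impI)
    fix B :: "nat \<Rightarrow> 'a set"
    assume B: "range B \<subseteq> sets (empirical n S)" "disjoint_family B"
    have "(\<Sum>j. ennreal (1 / real n) * (\<Sum>i\<in>{1..n}. emeasure (return borel (S i)) (B j)))
      = ennreal (1 / real n) * (\<Sum>i\<in>{1..n}. \<Sum>j. emeasure (return borel (S i)) (B j))"
      by (simp add: ennreal_suminf_cmult suminf_sum[symmetric] summableI)
    also have "\<dots> = ennreal (1 / real n) * (\<Sum>i\<in>{1..n}. emeasure (return borel (S i)) (\<Union>j. B j))"
      using B by (intro arg_cong2[where f = "(*)"] sum.cong refl suminf_emeasure) auto
    finally show "(\<Sum>j. ennreal (1 / real n) * (\<Sum>i\<in>{1..n}. emeasure (return borel (S i)) (B j)))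
      = ennreal (1 / real n) * (\<Sum>i\<in>{1..n}. emeasure (return borel (S i)) (\<Union>j. B j))" .
  qed
qed (use assms in \<open>auto simp: positive_def\<close>)

abbreviation iid_sample :: "nat \<Rightarrow> 'a measure \<Rightarrow> (nat \<Rightarrow> 'a) measure" where
  "iid_sample n P \<equiv> Pi\<^sub>M {1..n} (\<lambda>_. P)"

definition empirical_risk ::
    "('a::topological_space \<Rightarrow> real) set \<Rightarrow> nat \<Rightarrow> (nat \<Rightarrow> 'a) \<Rightarrow> 'a measure \<Rightarrow> real" where
  "empirical_risk F n S Q = (\<integral>T. ipm F (empirical n S) (empirical n T) \<partial>iid_sample n Q)"

(* Note the argument order: RN_deriv M N is the density of N with respect to M. *)
definition log_density :: "'b measure \<Rightarrow> 'b measure \<Rightarrow> 'b \<Rightarrow> real" where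
  "log_density \<rho> \<pi> g = ln (enn2real (RN_deriv \<pi> \<rho> g))"

(* The expectation of the log-density in the extended reals, as the integral of its positive part
   minus that of its negative part: the divergence may be infinite, in which case the library's
   real-valued KL_divergence would return 0. *)
definition KL :: "'b measure \<Rightarrow> 'b measure \<Rightarrow> ereal" where
  "KL \<rho> \<pi> = enn2ereal (\<integral>\<^sup>+g. ennreal (log_density \<rho> \<pi> g) \<partial>\<rho>)
          - enn2ereal (\<integral>\<^sup>+g. ennreal (- log_density \<rho> \<pi> g) \<partial>\<rho>)"

lemma KL_eq_KL_divergence:
  assumes "integrable \<rho> (log_density \<rho> \<pi>)"
  shows "KL \<rho> \<pi> = ereal (KL_divergence (exp 1) \<pi> \<rho>)"
proof -
  have "entropy_density (exp 1) \<pi> \<rho> = log_density \<rho> \<pi>"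
    by (simp add: fun_eq_iff entropy_density_def log_density_def log_def)
  moreover obtain r q where "0 \<le> r" "0 \<le> q"
    "(\<integral>\<^sup>+g. ennreal (log_density \<rho> \<pi> g) \<partial>\<rho>) = ennreal r"
    "(\<integral>\<^sup>+g. ennreal (- log_density \<rho> \<pi> g) \<partial>\<rho>) = ennreal q"
    "integral\<^sup>L \<rho> (log_density \<rho> \<pi>) = r - q"
    using integrableE[OF assms] by metis
  ultimately show ?thesis
    by (simp add: KL_def KL_divergence_def enn2ereal_ennreal)
qed

end

theory Submission
  imports Defs
begin

text \<open>
  Changing one of the \<open>n\<close> sample points moves the empirical risk by at most \<open>\<Delta> / n\<close>, so McDiarmid's
  argument (Hoeffding's lemma, one coordinate at a time) bounds the exponential moment of
  \<open>\<lambda> (E W - W)\<close> by \<open>exp (\<lambda>\<^sup>2 \<Delta>\<^sup>2 / (8 n))\<close> for each fixed generator. Averaging over the prior and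
  passing from \<open>\<pi>\<close> to \<open>\<rho>\<close> introduces the factor \<open>exp (- ln (d\<rho>/d\<pi>))\<close>, and the resulting quantity
  has expectation at most \<open>1\<close> over the sample and \<open>g\<close> drawn from \<open>\<rho>\<close>. Markov's inequality for it
  gives (ii); Markov's inequality for its \<open>\<rho>\<close>-average followed by Jensen's inequality gives (i).
\<close>

section \<open>Exponential moments under bounded differences\<close>

text \<open>An oscillation bound \<open>c\<close> confines \<open>X\<close> to the interval of
  length \<open>c\<close> that starts at its infimum, and the constant in Hoeffding's lemma depends
  only on that length. This form suits bounded differences, where no common interval is known in
  advance.\<close>

lemma (in prob_space) Hoeffdings_lemma_oscillation:
  fixes X :: "'a \<Rightarrow> real"
  assumes X: "X \<in> borel_measurable M"
    and osc: "\<And>x y. x \<in> space M \<Longrightarrow> y \<in> space M \<Longrightarrow> \<bar>X x - X y\<bar> \<le> c"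
    and l: "l > 0"
  shows "(\<integral>\<^sup>+x. ennreal (exp (l * (X x - expectation X))) \<partial>M) \<le> ennreal (exp (l\<^sup>2 * c\<^sup>2 / 8))"
proof -
  define a where "a = (INF x\<in>space M. X x)"
  obtain x0 where x0: "x0 \<in> space M" using not_empty by auto
  have "bdd_below (X ` space M)"
    using osc[OF x0] by (intro bdd_belowI2[where m = "X x0 - c"]) (smt (verit))
  then have lower: "a \<le> X x" if "x \<in> space M" for x
    unfolding a_def using that by (rule cINF_lower)
  have upper: "X x \<le> a + c" if "x \<in> space M" for x
  proof -
    have "X x - c \<le> a"
      unfolding a_def using not_empty osc[OF that]
      by (intro cINF_greatest) (auto simp: abs_le_iff, smt)
    then show ?thesis by simp
  qed
  interpret interval_bounded_random_variable M X a "a + c"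
    using X lower upper by unfold_locales auto
  show ?thesis
    using Hoeffdings_lemma_nn_integral[OF l] by simp
qed

lemma (in prob_space) abs_integral_le_const:
  fixes X :: "'a \<Rightarrow> real"
  assumes "\<And>x. x \<in> space M \<Longrightarrow> \<bar>X x\<bar> \<le> B"
  shows "\<bar>expectation X\<bar> \<le> B"
proof (cases "integrable M X")
  case True
  have "\<bar>expectation X\<bar> \<le> (\<integral>x. \<bar>X x\<bar> \<partial>M)" by (rule integral_abs_bound)
  also have "\<dots> \<le> B" using True assms by (intro integral_le_const) auto
  finally show ?thesis .
next
  \<comment> \<open>The integral of a non-integrable function is 0 by convention, and
    \<open>B\<close> is nonnegative because a probability space is nonempty.\<close>
  case False
  obtain x where "x \<in> space M" using not_empty by auto
  with assms[of x] False show ?thesis by (simp add: not_integrable_integral_eq)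
qed

lemma (in prob_space) integrable_bounded:
  fixes X :: "'a \<Rightarrow> real"
  assumes "X \<in> borel_measurable M" "\<And>x. x \<in> space M \<Longrightarrow> \<bar>X x\<bar> \<le> B"
  shows "integrable M X"
  using assms by (intro integrable_const_bound[where B = B]) auto

text \<open>McDiarmid's argument by induction on the index set. Averaging \<open>f\<close> over the
  new coordinate gives a function \<open>g\<close> with the same mean and the same bounded
  differences in the remaining coordinates; Hoeffding's lemma for the new coordinate contributes the
  factor with exponent \<open>l^2 * (c i)^2 / 8\<close>. The bound \<open>B\<close> provides
  integrability. The induction varies \<open>f\<close>, since its hypothesis is applied to
  \<open>g\<close>.\<close>

lemma bounded_differences_exp_moment:
  fixes M :: "'i \<Rightarrow> 'a measure" and f :: "('i \<Rightarrow> 'a) \<Rightarrow> real"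
  assumes M: "\<And>i. prob_space (M i)" and "finite I" and l: "l > 0"
    and "f \<in> borel_measurable (Pi\<^sub>M I M)"
    and "\<And>S. S \<in> space (Pi\<^sub>M I M) \<Longrightarrow> \<bar>f S\<bar> \<le> B"
    and "\<And>S i x. S \<in> space (Pi\<^sub>M I M) \<Longrightarrow> i \<in> I \<Longrightarrow> x \<in> space (M i) \<Longrightarrow> \<bar>f (S(i := x)) - f S\<bar> \<le> c i"
  shows "(\<integral>\<^sup>+S. ennreal (exp (l * (f S - (\<integral>S'. f S' \<partial>Pi\<^sub>M I M)))) \<partial>Pi\<^sub>M I M)
    \<le> ennreal (exp (l\<^sup>2 * (\<Sum>i\<in>I. (c i)\<^sup>2) / 8))"
  using assms(2,4-)
proof (induction I arbitrary: f rule: finite_induct)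
  case empty
  interpret product_prob_space M "{}" using M by (simp add: product_prob_spaceI)
  show ?case
    by (simp add: PiM_empty nn_integral_count_space_finite lebesgue_integral_count_space_finite)
next
  case (insert i I)
  interpret product_prob_space M "insert i I" using M by (simp add: product_prob_spaceI)
  note J = prob_space_PiM[of "insert i I" M, OF M]
  note [measurable] = insert.prems(1)
  have upd: "S(i := x) \<in> space (Pi\<^sub>M (insert i I) M)"
    if "S \<in> space (Pi\<^sub>M I M)" "x \<in> space (M i)" for S x
    using that by (auto simp: space_PiM PiE_iff extensional_def)
  define g where "g S = (\<integral>x. f (S(i := x)) \<partial>M i)" for S
  have [measurable]: "g \<in> borel_measurable (Pi\<^sub>M I M)"
    unfolding g_def by measurable
  have fi: "(\<lambda>x. f (S(i := x))) \<in> borel_measurable (M i)" if "S \<in> space (Pi\<^sub>M I M)" for S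
    using that by measurable
  have int: "integrable (M i) (\<lambda>x. f (S(i := x)))" if "S \<in> space (Pi\<^sub>M I M)" for S
    using that by (intro prob_space.integrable_bounded[OF M, where B = B] fi insert.prems upd)
  have gB: "\<bar>g S\<bar> \<le> B" if "S \<in> space (Pi\<^sub>M I M)" for S
    unfolding g_def using that by (intro prob_space.abs_integral_le_const[OF M] insert.prems upd)
  \<comment> \<open>Updates at distinct coordinates commute, so the bounded difference of
    \<open>f\<close> at \<open>j\<close> holds under the integral over coordinate
    \<open>i\<close>.\<close>
  have gc: "\<bar>g (S(j := y)) - g S\<bar> \<le> c j"
    if S: "S \<in> space (Pi\<^sub>M I M)" and j: "j \<in> I" and y: "y \<in> space (M j)" for S j y
  proof -
    have ne: "j \<noteq> i" using j insert.hyps by auto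
    have S': "S(j := y) \<in> space (Pi\<^sub>M I M)"
      using S j y by (auto simp: space_PiM PiE_iff extensional_def)
    have "g (S(j := y)) - g S = (\<integral>x. f (S(j := y, i := x)) - f (S(i := x)) \<partial>M i)"
      unfolding g_def using int[OF S] int[OF S'] by simp
    also have "\<bar>\<dots>\<bar> \<le> c j"
    proof (rule prob_space.abs_integral_le_const[OF M])
      fix x assume x: "x \<in> space (M i)"
      show "\<bar>f (S(j := y, i := x)) - f (S(i := x))\<bar> \<le> c j"
        unfolding fun_upd_twist[OF ne]
        by (rule insert.prems(3)[OF upd[OF S x]]) (use j y in auto)
    qed
    finally show ?thesis .
  qed
  have mean: "(\<integral>S. f S \<partial>Pi\<^sub>M (insert i I) M) = (\<integral>S. g S \<partial>Pi\<^sub>M I M)"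
    unfolding g_def using insert.hyps
    by (intro product_integral_insert prob_space.integrable_bounded[OF J, where B = B] insert.prems) auto
  define m where "m = (\<integral>S. g S \<partial>Pi\<^sub>M I M)"
  have "(\<integral>\<^sup>+S. ennreal (exp (l * (f S - m))) \<partial>Pi\<^sub>M (insert i I) M)
    = (\<integral>\<^sup>+S. \<integral>\<^sup>+x. ennreal (exp (l * (f (S(i := x)) - m))) \<partial>M i \<partial>Pi\<^sub>M I M)"
    using insert.hyps by (intro product_nn_integral_insert) auto
  also have "\<dots> \<le> (\<integral>\<^sup>+S. ennreal (exp (l * (g S - m))) * ennreal (exp (l\<^sup>2 * (c i)\<^sup>2 / 8)) \<partial>Pi\<^sub>M I M)"
  proof (rule nn_integral_mono)
    fix S assume S: "S \<in> space (Pi\<^sub>M I M)"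
    \<comment> \<open>The deviation splits as \<open>f - m = (g - m) + (f - g)\<close>. The first
      part is constant in \<open>x\<close>, and the second is centred with respect to
      \<open>M i\<close>.\<close>
    note [measurable] = fi[OF S]
    have "(\<integral>\<^sup>+x. ennreal (exp (l * (f (S(i := x)) - m))) \<partial>M i)
      = (\<integral>\<^sup>+x. ennreal (exp (l * (g S - m))) * ennreal (exp (l * (f (S(i := x)) - g S))) \<partial>M i)"
      by (simp add: ennreal_mult[symmetric] exp_add[symmetric] algebra_simps)
    also have "\<dots> = ennreal (exp (l * (g S - m))) * (\<integral>\<^sup>+x. ennreal (exp (l * (f (S(i := x)) - g S))) \<partial>M i)"
      by (intro nn_integral_cmult) measurable
    also have "(\<integral>\<^sup>+x. ennreal (exp (l * (f (S(i := x)) - g S))) \<partial>M i) \<le> ennreal (exp (l\<^sup>2 * (c i)\<^sup>2 / 8))"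
      unfolding g_def
    proof (rule prob_space.Hoeffdings_lemma_oscillation[OF M fi[OF S] _ l])
      \<comment> \<open>The hypothesis compares a point with its own update. Taking
        \<open>S(i := y)\<close> as the base point makes it compare two arbitrary values at
        coordinate \<open>i\<close>, because the second update overwrites the first.\<close>
      fix x y assume x: "x \<in> space (M i)" and y: "y \<in> space (M i)"
      have "\<bar>f (S(i := y, i := x)) - f (S(i := y))\<bar> \<le> c i"
        by (rule insert.prems(3)[OF upd[OF S y]]) (use x in auto)
      then show "\<bar>f (S(i := x)) - f (S(i := y))\<bar> \<le> c i"
        by simp
    qed
    finally show "(\<integral>\<^sup>+x. ennreal (exp (l * (f (S(i := x)) - m))) \<partial>M i)
      \<le> ennreal (exp (l * (g S - m))) * ennreal (exp (l\<^sup>2 * (c i)\<^sup>2 / 8))"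
      by (simp add: mult_left_mono)
  qed
  also have "\<dots> = (\<integral>\<^sup>+S. ennreal (exp (l * (g S - m))) \<partial>Pi\<^sub>M I M) * ennreal (exp (l\<^sup>2 * (c i)\<^sup>2 / 8))"
    by (intro nn_integral_multc) measurable
  also have "\<dots> \<le> ennreal (exp (l\<^sup>2 * (\<Sum>i\<in>I. (c i)\<^sup>2) / 8)) * ennreal (exp (l\<^sup>2 * (c i)\<^sup>2 / 8))"
    unfolding m_def by (intro mult_right_mono insert.IH gB gc) auto
  also have "\<dots> = ennreal (exp (l\<^sup>2 * (\<Sum>i\<in>insert i I. (c i)\<^sup>2) / 8))"
    using insert.hyps by (simp add: ennreal_mult[symmetric] exp_add[symmetric] algebra_simps add_divide_distrib)
  finally show ?case by (simp add: mean m_def)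
qed

section \<open>Empirical integral probability metrics\<close>

text \<open>As the image of the uniform measure on the indices, the empirical measure has integrals
  that are finite averages.\<close>

lemma empirical_eq_distr:
  assumes "n \<ge> 1"
  shows "empirical n S = distr (uniform_count_measure {1..n}) borel S"
proof (rule measure_eqI)
  fix A assume "A \<in> sets (empirical n S)"
  then have A: "A \<in> sets borel" by simp
  have *: "S \<in> uniform_count_measure {1..n} \<rightarrow>\<^sub>M borel"
    by (simp add: measurable_def space_uniform_count_measure sets_uniform_count_measure)
  have "(\<Sum>i\<in>{1..n}. emeasure (return borel (S i)) A) = (\<Sum>i\<in>{1..n}. ennreal (indicator (S -` A) i))"
    using A by (intro sum.cong) (auto simp: indicator_def)
  also have "\<dots> = ennreal (real (card (S -` A \<inter> {1..n})))"
    by (subst sum_ennreal) (auto simp: indicator_def sum.If_cases Int_commute vimage_def)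
  finally have "emeasure (empirical n S) A = ennreal (1 / real n) * ennreal (real (card (S -` A \<inter> {1..n})))"
    using A by (simp only: emeasure_empirical)
  also have "\<dots> = emeasure (distr (uniform_count_measure {1..n}) borel S) A"
    using A assms
    by (simp add: emeasure_distr[OF *, simplified] space_uniform_count_measure emeasure_uniform_count_measure
        ennreal_mult[symmetric])
  finally show "emeasure (empirical n S) A = emeasure (distr (uniform_count_measure {1..n}) borel S) A" .
qed simp

lemma integral_empirical:
  fixes f :: "'a::topological_space \<Rightarrow> real"
  assumes "n \<ge> 1" "f \<in> borel_measurable borel"
  shows "(\<integral>x. f x \<partial>empirical n S) = (\<Sum>i=1..n. f (S i)) / real n"
proof -
  have *: "S \<in> uniform_count_measure {1..n} \<rightarrow>\<^sub>M borel"
    by (simp add: measurable_def space_uniform_count_measure sets_uniform_count_measure)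
  show ?thesis
    using assms by (simp add: empirical_eq_distr integral_distr[OF *, simplified] integral_uniform_count_measure)
qed

lemma lipschitz_1_oscillation:
  fixes f :: "'a::metric_space \<Rightarrow> real"
  assumes "bounded (UNIV :: 'a set)" "1-lipschitz_on UNIV f"
  shows "\<bar>f x - f y\<bar> \<le> diameter (UNIV :: 'a set)"
  using lipschitz_onD[OF assms(2), of x y] diameter_bounded_bound[OF assms(1), of x y]
  by (simp add: dist_real_def)

lemma lipschitz_borel_measurable:
  fixes f :: "'a::metric_space \<Rightarrow> real"
  assumes "1-lipschitz_on UNIV f"
  shows "f \<in> borel_measurable borel"
  using assms by (intro borel_measurable_continuous_onI lipschitz_on_continuous_on)

context
  fixes F :: "('a::metric_space \<Rightarrow> real) set" and n :: nat
  assumes bdd: "bounded (UNIV :: 'a set)"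
    and lip: "\<forall>f\<in>F. 1-lipschitz_on UNIV f"
    and n: "n \<ge> 1"
begin

text \<open>Pairing the \<open>i\<close>-th points of the two samples bounds every summand by the
  diameter. The bound is uniform over \<open>F\<close>, so the real supremum in \<open>ipm\<close>
  is taken over a bounded set.\<close>

lemma empirical_mean_difference_le:
  assumes f: "f \<in> F"
  shows "\<bar>(\<integral>x. f x \<partial>empirical n S) - (\<integral>x. f x \<partial>empirical n T)\<bar> \<le> diameter (UNIV :: 'a set)"
proof -
  have fl: "1-lipschitz_on UNIV f" using lip f by auto
  have "(\<integral>x. f x \<partial>empirical n S) - (\<integral>x. f x \<partial>empirical n T) = (\<Sum>i=1..n. f (S i) - f (T i)) / n"
    by (simp add: integral_empirical[OF n lipschitz_borel_measurable[OF fl]] sum_subtractf diff_divide_distrib)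
  also have "\<bar>\<dots>\<bar> \<le> (\<Sum>i=1..n. \<bar>f (S i) - f (T i)\<bar>) / n"
    by (simp add: divide_right_mono sum_abs)
  also have "\<dots> \<le> (\<Sum>i=1..n. diameter (UNIV :: 'a set)) / n"
    by (intro divide_right_mono sum_mono lipschitz_1_oscillation[OF bdd fl]) auto
  finally show ?thesis using n by simp
qed

text \<open>Only the summand at \<open>i\<close> changes, and it has weight \<open>1 / n\<close>.
  This is the source of the difference constant in McDiarmid's argument.\<close>

lemma empirical_mean_update_le:
  assumes f: "f \<in> F" and i: "i \<in> {1..n}"
  shows "\<bar>(\<integral>x. f x \<partial>empirical n (S(i := y))) - (\<integral>x. f x \<partial>empirical n S)\<bar> \<le> diameter (UNIV :: 'a set) / n"
proof -
  have fl: "1-lipschitz_on UNIV f" using lip f by auto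
  have "(\<Sum>j=1..n. f ((S(i := y)) j) - f (S j)) = (\<Sum>j=1..n. if j = i then f y - f (S i) else 0)"
    by (intro sum.cong) auto
  also have "\<dots> = f y - f (S i)" using i by simp
  finally have "(\<integral>x. f x \<partial>empirical n (S(i := y))) - (\<integral>x. f x \<partial>empirical n S) = (f y - f (S i)) / n"
    by (simp add: integral_empirical[OF n lipschitz_borel_measurable[OF fl]] sum_subtractf
        diff_divide_distrib[symmetric])
  then show ?thesis
    using lipschitz_1_oscillation[OF bdd fl, of y "S i"] by (simp add: divide_right_mono)
qed

lemma bdd_above_empirical_mean_difference:
  "bdd_above ((\<lambda>f. \<bar>(\<integral>x. f x \<partial>empirical n S) - (\<integral>x. f x \<partial>empirical n T)\<bar>) ` F)"
  using empirical_mean_difference_le by (intro bdd_aboveI2)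

text \<open>The term \<open>\<bar>Sup {}\<bar>\<close> covers empty \<open>F\<close>, where the supremum is an unspecified constant.\<close>

lemma abs_ipm_empirical_le:
  "\<bar>ipm F (empirical n S) (empirical n T)\<bar> \<le> diameter (UNIV :: 'a set) + \<bar>Sup {}\<bar>"
proof (cases "F = {}")
  case True
  then show ?thesis using diameter_ge_0[OF bdd] by (simp add: ipm_def)
next
  case False
  then obtain f where f: "f \<in> F" by auto
  have "0 \<le> ipm F (empirical n S) (empirical n T)"
    unfolding ipm_def by (rule cSUP_upper2[OF bdd_above_empirical_mean_difference f]) simp
  moreover have "ipm F (empirical n S) (empirical n T) \<le> diameter (UNIV :: 'a set)"
    unfolding ipm_def using False by (intro cSUP_least empirical_mean_difference_le)
  ultimately show ?thesis by simp
qed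

text \<open>By the triangle inequality, a perturbation of the first means that is uniform over
  \<open>F\<close> passes to the supremum. The statement is one-sided so that exchanging
  \<open>S\<close> and \<open>S'\<close> yields the absolute value. For empty \<open>F\<close> both
  sides contain the same constant.\<close>

lemma ipm_empirical_perturb:
  assumes close: "\<And>f. f \<in> F \<Longrightarrow> \<bar>(\<integral>x. f x \<partial>empirical n S) - (\<integral>x. f x \<partial>empirical n S')\<bar> \<le> c"
    and c: "c \<ge> 0"
  shows "ipm F (empirical n S) (empirical n T) \<le> ipm F (empirical n S') (empirical n T) + c"
proof (cases "F = {}")
  case True
  then show ?thesis using c by (simp add: ipm_def)
next
  case False
  show ?thesis unfolding ipm_def[of F "empirical n S"]
  proof (rule cSUP_least[OF False])
    fix f assume f: "f \<in> F"
    have "\<bar>(\<integral>x. f x \<partial>empirical n S') - (\<integral>x. f x \<partial>empirical n T)\<bar> \<le> ipm F (empirical n S') (empirical n T)"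
      unfolding ipm_def by (rule cSUP_upper[OF f bdd_above_empirical_mean_difference])
    then show "\<bar>(\<integral>x. f x \<partial>empirical n S) - (\<integral>x. f x \<partial>empirical n T)\<bar>
      \<le> ipm F (empirical n S') (empirical n T) + c"
      using close[OF f] by linarith
  qed
qed

lemma ipm_empirical_bounded_differences:
  assumes i: "i \<in> {1..n}"
  shows "\<bar>ipm F (empirical n (S(i := y))) (empirical n T) - ipm F (empirical n S) (empirical n T)\<bar>
    \<le> diameter (UNIV :: 'a set) / n"
proof -
  have "0 \<le> diameter (UNIV :: 'a set) / n" using diameter_ge_0[OF bdd] by simp
  from ipm_empirical_perturb[OF _ this, of "S(i := y)" S T]
    ipm_empirical_perturb[OF _ this, of S "S(i := y)" T]
  show ?thesis
    using empirical_mean_update_le[OF _ i, of _ S y] by (auto simp: abs_le_iff abs_minus_commute)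
qed

end

section \<open>Measurability of product kernels\<close>

text \<open>Measurable rectangles form an intersection-stable generator, and on them the product
  measure is a finite product of measurable functions of \<open>g\<close>. Thus drawing an i.i.d.
  sample from a kernel is again a kernel.\<close>

lemma measurable_PiM_prob_algebra:
  assumes "finite I" and K: "K \<in> measurable N (prob_algebra L)"
  shows "(\<lambda>g. Pi\<^sub>M I (\<lambda>_. K g)) \<in> measurable N (prob_algebra (Pi\<^sub>M I (\<lambda>_. L)))"
proof (rule measurable_prob_algebra_generated[OF sets_PiM Int_stable_prod_algebra prod_algebra_sets_into_space])
  fix g assume "g \<in> space N"
  then have "K g \<in> space (prob_algebra L)" using K by (rule measurable_space[rotated])
  then have "prob_space (K g)" "sets (K g) = sets L" by (auto simp: space_prob_algebra)
  then show "prob_space (Pi\<^sub>M I (\<lambda>_. K g))" "sets (Pi\<^sub>M I (\<lambda>_. K g)) = sets (Pi\<^sub>M I (\<lambda>_. L))"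
    by (auto intro: prob_space_PiM cong: sets_PiM_cong)
next
  fix A assume "A \<in> prod_algebra I (\<lambda>_. L)"
  then obtain E where A: "A = Pi\<^sub>E I E" and E: "\<And>i. i \<in> I \<Longrightarrow> E i \<in> sets L"
    by (elim prod_algebraE_all) auto
  have "(\<lambda>g. \<Prod>i\<in>I. emeasure (K g) (E i)) \<in> borel_measurable N"
    using E by (intro borel_measurable_prod_ennreal measurable_emeasure_kernel[OF measurable_prob_algebraD[OF K]])
  also have "?this \<longleftrightarrow> (\<lambda>g. emeasure (Pi\<^sub>M I (\<lambda>_. K g)) A) \<in> borel_measurable N"
  proof (rule measurable_cong)
    fix g assume "g \<in> space N"
    then have "K g \<in> space (prob_algebra L)" using K by (rule measurable_space[rotated])
    then have p: "prob_space (K g)" and s: "sets (K g) = sets L" by (auto simp: space_prob_algebra)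
    interpret product_prob_space "\<lambda>_. K g" I using p by (simp add: product_prob_spaceI)
    show "(\<Prod>i\<in>I. emeasure (K g) (E i)) = emeasure (Pi\<^sub>M I (\<lambda>_. K g)) A"
      unfolding A using assms(1) E s by (intro emeasure_PiM[symmetric]) auto
  qed
  finally show "(\<lambda>g. emeasure (Pi\<^sub>M I (\<lambda>_. K g)) A) \<in> borel_measurable N" .
qed

text \<open>The integrals of the positive and negative parts depend measurably on the parameter.
  Boundedness makes both finite, so their difference is the real integral.\<close>

lemma measurable_integral_kernel:
  fixes f :: "'a \<Rightarrow> 'b \<Rightarrow> real"
  assumes f [measurable]: "case_prod f \<in> borel_measurable (M \<Otimes>\<^sub>M N)"
    and L [measurable]: "L \<in> measurable M (prob_algebra N)"
    and bounded: "\<And>x y. \<bar>f x y\<bar> \<le> B"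
  shows "(\<lambda>x. \<integral>y. f x y \<partial>L x) \<in> borel_measurable M"
proof -
  note L' [measurable] = measurable_prob_algebraD[OF L]
  have "(\<lambda>x. enn2real (\<integral>\<^sup>+y. ennreal (f x y) \<partial>L x) - enn2real (\<integral>\<^sup>+y. ennreal (- f x y) \<partial>L x))
      \<in> borel_measurable M"
    by (intro borel_measurable_diff
        measurable_compose[OF nn_integral_measurable_subprob_algebra2[OF _ L'] borel_measurable_enn2real])
      measurable
  also have "?this \<longleftrightarrow> (\<lambda>x. \<integral>y. f x y \<partial>L x) \<in> borel_measurable M"
  proof (rule measurable_cong)
    fix x assume x: "x \<in> space M"
    then have "L x \<in> space (prob_algebra N)" using L by (rule measurable_space[rotated])
    then have p: "prob_space (L x)" and s: "sets (L x) = sets N" by (auto simp: space_prob_algebra)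
    have "f x \<in> borel_measurable N" using x by measurable
    then have "f x \<in> borel_measurable (L x)" using s by (simp cong: measurable_cong_sets)
    then have "integrable (L x) (f x)"
      using bounded by (intro prob_space.integrable_bounded[OF p, where B = B])
    then show "enn2real (\<integral>\<^sup>+y. ennreal (f x y) \<partial>L x) - enn2real (\<integral>\<^sup>+y. ennreal (- f x y) \<partial>L x)
      = (\<integral>y. f x y \<partial>L x)"
      by (simp add: real_lebesgue_integral_def)
  qed
  finally show ?thesis .
qed

section \<open>Change of measure and PAC-Bayes bounds\<close>

lemma log_density_measurable:
  assumes "sets \<rho> = sets \<pi>"
  shows "log_density \<rho> \<pi> \<in> borel_measurable \<rho>"
proof -
  have "log_density \<rho> \<pi> \<in> borel_measurable \<pi>"
    unfolding log_density_def by measurable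
  then show ?thesis using assms by (simp cong: measurable_cong_sets)
qed

text \<open>Under \<open>\<pi>\<close> the density cancels against the exponential wherever it is
  positive. Where it vanishes, the transformed integrand is 0 while \<open>f\<close> may still
  contribute on the right, hence an inequality.\<close>

lemma change_of_measure_le:
  assumes "prob_space \<pi>" "prob_space \<rho>" and sets: "sets \<rho> = sets \<pi>"
    and ac: "absolutely_continuous \<pi> \<rho>" and f: "f \<in> borel_measurable \<rho>"
  shows "(\<integral>\<^sup>+g. f g * ennreal (exp (- log_density \<rho> \<pi> g)) \<partial>\<rho>) \<le> (\<integral>\<^sup>+g. f g \<partial>\<pi>)"
proof -
  interpret \<pi>: prob_space \<pi> by fact
  interpret \<rho>: prob_space \<rho> by fact
  have [measurable]: "f \<in> borel_measurable \<pi>" using f sets by (simp cong: measurable_cong_sets)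
  have [measurable]: "log_density \<rho> \<pi> \<in> borel_measurable \<pi>"
    unfolding log_density_def by measurable
  have "(\<integral>\<^sup>+g. f g * ennreal (exp (- log_density \<rho> \<pi> g)) \<partial>\<rho>)
    = (\<integral>\<^sup>+g. RN_deriv \<pi> \<rho> g * (f g * ennreal (exp (- log_density \<rho> \<pi> g))) \<partial>\<pi>)"
    by (intro \<pi>.RN_deriv_nn_integral ac sets) measurable
  also have "\<dots> \<le> (\<integral>\<^sup>+g. f g \<partial>\<pi>)"
  proof (rule nn_integral_mono_AE)
    have "AE g in \<pi>. RN_deriv \<pi> \<rho> g \<noteq> \<infinity>"
      using \<pi>.RN_deriv_finite[OF \<rho>.sigma_finite_measure_axioms ac sets] .
    then show "AE g in \<pi>. RN_deriv \<pi> \<rho> g * (f g * ennreal (exp (- log_density \<rho> \<pi> g))) \<le> f g"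
    proof eventually_elim
      case (elim g)
      then obtain r where r: "RN_deriv \<pi> \<rho> g = ennreal r" "r \<ge> 0"
        by (cases "RN_deriv \<pi> \<rho> g") auto
      \<comment> \<open>For positive \<open>r\<close> the product is exactly 1; for
        \<open>r = 0\<close> it is 0, whatever value the logarithm takes there.\<close>
      have "r * exp (- log_density \<rho> \<pi> g) \<le> 1"
        using r by (cases "r = 0") (auto simp: log_density_def exp_minus)
      then have "ennreal r * ennreal (exp (- log_density \<rho> \<pi> g)) \<le> 1"
        using r by (simp add: ennreal_mult[symmetric])
      then have "f g * (ennreal r * ennreal (exp (- log_density \<rho> \<pi> g))) \<le> f g * 1"
        by (intro mult_left_mono) auto
      then show ?case by (simp add: r mult_ac)
    qed
  qed
  finally show ?thesis .
qed

text \<open>The divergence is never of the form infinity minus infinity: the negative part of the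
  log-density is at most \<open>exp (- log_density \<rho> \<pi> g)\<close>, whose
  \<open>\<rho>\<close>-integral is at most 1 by the change of measure applied to the constant
  1.\<close>

lemma KL_cases:
  assumes "prob_space \<pi>" "prob_space \<rho>" and sets: "sets \<rho> = sets \<pi>"
    and ac: "absolutely_continuous \<pi> \<rho>"
  obtains (infinite) "KL \<rho> \<pi> = \<infinity>"
  | (finite) "integrable \<rho> (log_density \<rho> \<pi>)" "KL \<rho> \<pi> = ereal (\<integral>g. log_density \<rho> \<pi> g \<partial>\<rho>)"
proof -
  interpret \<pi>: prob_space \<pi> by fact
  note [measurable] = log_density_measurable[OF sets]
  have "(\<integral>\<^sup>+g. ennreal (- log_density \<rho> \<pi> g) \<partial>\<rho>) \<le> (\<integral>\<^sup>+g. 1 * ennreal (exp (- log_density \<rho> \<pi> g)) \<partial>\<rho>)"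
  proof (intro nn_integral_mono)
    fix g
    show "ennreal (- log_density \<rho> \<pi> g) \<le> 1 * ennreal (exp (- log_density \<rho> \<pi> g))"
      using exp_ge_add_one_self[of "- log_density \<rho> \<pi> g"] by (auto intro!: ennreal_leI)
  qed
  also have "\<dots> \<le> (\<integral>\<^sup>+g. 1 \<partial>\<pi>)" by (rule change_of_measure_le[OF assms]) simp
  also have "\<dots> = 1" by (simp add: \<pi>.emeasure_space_1)
  finally have neg: "(\<integral>\<^sup>+g. ennreal (- log_density \<rho> \<pi> g) \<partial>\<rho>) < \<infinity>"
    by (auto simp: less_top[symmetric] top_unique)
  show thesis
  proof (cases "(\<integral>\<^sup>+g. ennreal (log_density \<rho> \<pi> g) \<partial>\<rho>) = \<infinity>")
    case True
    obtain q where "(\<integral>\<^sup>+g. ennreal (- log_density \<rho> \<pi> g) \<partial>\<rho>) = ennreal q" "q \<ge> 0"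
      using neg by (cases "\<integral>\<^sup>+g. ennreal (- log_density \<rho> \<pi> g) \<partial>\<rho>") auto
    with True show thesis by (intro infinite) (simp add: KL_def enn2ereal_ennreal)
  next
    case False
    then have int: "integrable \<rho> (log_density \<rho> \<pi>)"
      using neg by (auto simp: real_integrable_def)
    obtain r q where "0 \<le> r" "0 \<le> q"
      "(\<integral>\<^sup>+g. ennreal (log_density \<rho> \<pi> g) \<partial>\<rho>) = ennreal r"
      "(\<integral>\<^sup>+g. ennreal (- log_density \<rho> \<pi> g) \<partial>\<rho>) = ennreal q"
      "integral\<^sup>L \<rho> (log_density \<rho> \<pi>) = r - q"
      using integrableE[OF int] by metis
    then show thesis by (intro finite int) (simp add: KL_def enn2ereal_ennreal)
  qed
qed

text \<open>Failure of \<open>Q\<close> forces \<open>Z\<close> to be at least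
  \<open>1 / \<delta>\<close>, and by Markov's inequality this has probability at most
  \<open>\<delta>\<close>. Both PAC-Bayes bounds end with this argument.\<close>

lemma (in prob_space) Markov_complement:
  assumes [measurable]: "Z \<in> borel_measurable M" and Z: "(\<integral>\<^sup>+x. Z x \<partial>M) \<le> 1"
    and \<delta>: "0 < \<delta>" and [measurable]: "Measurable.pred M Q"
    and imp: "\<And>x. x \<in> space M \<Longrightarrow> ennreal \<delta> * Z x < 1 \<Longrightarrow> Q x"
  shows "\<P>(x in M. Q x) \<ge> 1 - \<delta>"
proof -
  have "emeasure M {x\<in>space M. \<not> Q x} \<le> emeasure M {x\<in>space M. 1 \<le> ennreal \<delta> * Z x}"
    using imp by (intro emeasure_mono) (auto simp: not_less[symmetric])
  also have "\<dots> \<le> ennreal \<delta> * (\<integral>\<^sup>+x. Z x * indicator (space M) x \<partial>M)"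
    by (intro nn_integral_Markov_inequality) auto
  also have "(\<integral>\<^sup>+x. Z x * indicator (space M) x \<partial>M) = (\<integral>\<^sup>+x. Z x \<partial>M)"
    by (intro nn_integral_cong) auto
  also have "ennreal \<delta> * (\<integral>\<^sup>+x. Z x \<partial>M) \<le> ennreal \<delta> * 1"
    using Z by (intro mult_left_mono) auto
  finally have "prob {x\<in>space M. \<not> Q x} \<le> \<delta>"
    using \<delta> by (simp add: emeasure_eq_measure)
  moreover have "prob {x\<in>space M. \<not> Q x} = 1 - \<P>(x in M. Q x)"
    by (intro prob_neg) measurable
  ultimately show ?thesis by simp
qed

section \<open>PAC-Bayes bounds from an exponential moment condition\<close>

context
  fixes M :: "'s measure" and \<pi> \<rho> :: "'g measure" and X :: "'s \<Rightarrow> 'g \<Rightarrow> real" and \<delta> :: real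
  assumes M: "prob_space M" and \<pi>: "prob_space \<pi>" and \<rho>: "prob_space \<rho>"
    and sets: "sets \<rho> = sets \<pi>" and ac: "absolutely_continuous \<pi> \<rho>"
    and X: "case_prod X \<in> borel_measurable (M \<Otimes>\<^sub>M \<rho>)"
    and moment: "\<And>g. g \<in> space \<rho> \<Longrightarrow> (\<integral>\<^sup>+S. ennreal (exp (X S g)) \<partial>M) \<le> 1"
    and \<delta>: "0 < \<delta>"
begin

interpretation M: prob_space M by (rule M)
interpretation \<pi>: prob_space \<pi> by (rule \<pi>)
interpretation \<rho>: prob_space \<rho> by (rule \<rho>)
interpretation M\<rho>: pair_prob_space M \<rho> ..
interpretation M\<pi>: pair_prob_space M \<pi> ..

text \<open>The change of measure replaces \<open>\<rho>\<close> by the prior. As the prior does not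
  depend on the sample, Fubini brings the sample integral inside, where the moment bound holds for
  each fixed \<open>g\<close>.\<close>

lemma joint_exp_moment_le:
  "(\<integral>\<^sup>+S. \<integral>\<^sup>+g. ennreal (exp (X S g - log_density \<rho> \<pi> g)) \<partial>\<rho> \<partial>M) \<le> 1"
proof -
  note [measurable] = X log_density_measurable[OF sets]
  have X': "case_prod X \<in> borel_measurable (M \<Otimes>\<^sub>M \<pi>)"
    using X sets by (simp cong: measurable_cong_sets sets_pair_measure_cong)
  note [measurable] = X'
  have "(\<integral>\<^sup>+S. \<integral>\<^sup>+g. ennreal (exp (X S g - log_density \<rho> \<pi> g)) \<partial>\<rho> \<partial>M)
    = (\<integral>\<^sup>+S. \<integral>\<^sup>+g. ennreal (exp (X S g)) * ennreal (exp (- log_density \<rho> \<pi> g)) \<partial>\<rho> \<partial>M)"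
    by (simp add: ennreal_mult[symmetric] exp_add[symmetric])
  also have "\<dots> \<le> (\<integral>\<^sup>+S. \<integral>\<^sup>+g. ennreal (exp (X S g)) \<partial>\<pi> \<partial>M)"
    by (intro nn_integral_mono change_of_measure_le[OF \<pi> \<rho> sets ac]) measurable
  also have "\<dots> = (\<integral>\<^sup>+g. \<integral>\<^sup>+S. ennreal (exp (X S g)) \<partial>M \<partial>\<pi>)"
    by (intro M\<pi>.Fubini'[symmetric]) measurable
  also have "\<dots> \<le> (\<integral>\<^sup>+g. 1 \<partial>\<pi>)"
    using moment sets_eq_imp_space_eq[OF sets] by (intro nn_integral_mono) auto
  finally show ?thesis by (simp add: \<pi>.emeasure_space_1)
qed

text \<open>Markov's inequality on the product space, applied to the exponential of
  \<open>X S g - log_density \<rho> \<pi> g\<close>; taking logarithms gives the event.\<close>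

lemma pac_bayes_pointwise:
  "\<P>((S, g) in M \<Otimes>\<^sub>M \<rho>. X S g \<le> log_density \<rho> \<pi> g + ln (1 / \<delta>)) \<ge> 1 - \<delta>"
proof -
  note [measurable] = X log_density_measurable[OF sets]
  have "\<P>(p in M \<Otimes>\<^sub>M \<rho>. (\<lambda>(S, g). X S g \<le> log_density \<rho> \<pi> g + ln (1 / \<delta>)) p) \<ge> 1 - \<delta>"
  proof (rule M\<rho>.Markov_complement[OF _ _ \<delta>])
    let ?Z = "\<lambda>(S, g). ennreal (exp (X S g - log_density \<rho> \<pi> g))"
    show "?Z \<in> borel_measurable (M \<Otimes>\<^sub>M \<rho>)" by measurable
    show "(\<integral>\<^sup>+p. ?Z p \<partial>(M \<Otimes>\<^sub>M \<rho>)) \<le> 1"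
      using joint_exp_moment_le by (subst \<rho>.nn_integral_fst[symmetric]) auto
    show "Measurable.pred (M \<Otimes>\<^sub>M \<rho>) (\<lambda>(S, g). X S g \<le> log_density \<rho> \<pi> g + ln (1 / \<delta>))"
      by measurable
    fix p assume less: "ennreal \<delta> * ?Z p < 1"
    obtain S g where p: "p = (S, g)" by fastforce
    have "\<delta> * exp (X S g - log_density \<rho> \<pi> g) < 1"
      using less \<delta> by (simp add: p ennreal_mult[symmetric])
    then have "exp (X S g - log_density \<rho> \<pi> g) < exp (ln (1 / \<delta>))"
      using \<delta> by (simp add: field_simps)
    then show "(\<lambda>(S, g). X S g \<le> log_density \<rho> \<pi> g + ln (1 / \<delta>)) p"
      unfolding exp_less_cancel_iff by (simp add: p)
  qed
  also have "{p \<in> space (M \<Otimes>\<^sub>M \<rho>). (\<lambda>(S, g). X S g \<le> log_density \<rho> \<pi> g + ln (1 / \<delta>)) p}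
    = {(S, g). (S, g) \<in> space (M \<Otimes>\<^sub>M \<rho>) \<and> X S g \<le> log_density \<rho> \<pi> g + ln (1 / \<delta>)}"
    by auto
  finally show ?thesis .
qed

text \<open>Markov's inequality over the sample alone, applied to the \<open>\<rho>\<close>-average
  of the same exponential; Jensen's inequality then moves the average into the exponent. An infinite
  divergence makes the event trivial.\<close>

lemma pac_bayes_expectation:
  assumes bounded: "\<And>S g. S \<in> space M \<Longrightarrow> g \<in> space \<rho> \<Longrightarrow> \<bar>X S g\<bar> \<le> B"
  shows "\<P>(S in M. ereal (\<integral>g. X S g \<partial>\<rho>) \<le> KL \<rho> \<pi> + ereal (ln (1 / \<delta>))) \<ge> 1 - \<delta>"
proof (rule M.Markov_complement[OF _ joint_exp_moment_le \<delta>])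
  note [measurable] = X log_density_measurable[OF sets]
  show "(\<lambda>S. \<integral>\<^sup>+g. ennreal (exp (X S g - log_density \<rho> \<pi> g)) \<partial>\<rho>) \<in> borel_measurable M"
    by measurable
  show "Measurable.pred M (\<lambda>S. ereal (\<integral>g. X S g \<partial>\<rho>) \<le> KL \<rho> \<pi> + ereal (ln (1 / \<delta>)))"
    by measurable
  fix S assume S: "S \<in> space M"
    and less: "ennreal \<delta> * (\<integral>\<^sup>+g. ennreal (exp (X S g - log_density \<rho> \<pi> g)) \<partial>\<rho>) < 1"
  have XS [measurable]: "X S \<in> borel_measurable \<rho>" using S by measurable
  show "ereal (\<integral>g. X S g \<partial>\<rho>) \<le> KL \<rho> \<pi> + ereal (ln (1 / \<delta>))"
  proof (cases rule: KL_cases[OF \<pi> \<rho> sets ac])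
    case 1
    then show ?thesis by simp
  next
    case 2
    let ?Y = "\<lambda>g. X S g - log_density \<rho> \<pi> g"
    have intX: "integrable \<rho> (X S)"
      using bounded[OF S] by (intro \<rho>.integrable_bounded[where B = B] XS)
    have intY: "integrable \<rho> ?Y" using intX 2 by simp
    \<comment> \<open>An infinite integral would make the product with the positive
      \<open>\<delta>\<close> infinite, contradicting \<open>less\<close>.\<close>
    have fin: "(\<integral>\<^sup>+g. ennreal (exp (?Y g)) \<partial>\<rho>) < \<infinity>"
      using less \<delta> by (auto simp: less_top[symmetric] ennreal_mult_top)
    then have intE: "integrable \<rho> (\<lambda>g. exp (?Y g))"
      by (intro integrableI_nonneg) auto
    have eq: "(\<integral>\<^sup>+g. ennreal (exp (?Y g)) \<partial>\<rho>) = ennreal (\<integral>g. exp (?Y g) \<partial>\<rho>)"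
      by (intro nn_integral_eq_integral intE) auto
    have small: "\<delta> * (\<integral>g. exp (?Y g) \<partial>\<rho>) \<le> 1"
      using less \<delta> by (simp add: eq ennreal_mult[symmetric])
    \<comment> \<open>Jensen's inequality, by integrating the tangent line of \<open>ln\<close> at \<open>1 / \<delta>\<close>.\<close>
    have "(\<integral>g. ?Y g \<partial>\<rho>) \<le> (\<integral>g. ln (1 / \<delta>) - 1 + \<delta> * exp (?Y g) \<partial>\<rho>)"
    proof (intro integral_mono intY)
      fix g
      show "?Y g \<le> ln (1 / \<delta>) - 1 + \<delta> * exp (?Y g)"
        using ln_le_minus_one[of "\<delta> * exp (?Y g)"] \<delta> by (simp add: ln_mult ln_div)
    qed (use intE in auto)
    also have "\<dots> = ln (1 / \<delta>) - 1 + \<delta> * (\<integral>g. exp (?Y g) \<partial>\<rho>)"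
      using intE by (simp add: \<rho>.prob_space)
    finally have "(\<integral>g. ?Y g \<partial>\<rho>) \<le> ln (1 / \<delta>)" using small by simp
    then show ?thesis using intX 2 by simp
  qed
qed

end

section \<open>PAC-Bayes bounds for the empirical risk of generators\<close>

theorem theorem3p1:
  fixes F :: "('a::metric_space \<Rightarrow> real) set"
    and P :: "'a measure"
    and n :: nat
    and \<G> :: "'g measure"
    and K :: "'g \<Rightarrow> 'a measure"
    and \<pi> \<rho> :: "'g measure"
    and lam \<delta> :: real
  assumes "bounded (UNIV :: 'a set)"
    and "\<forall>f\<in>F. 1-lipschitz_on UNIV f"
    and "symmetric_class F"
    and "prob_space P" and "sets P = sets borel"
    and "n \<ge> 1"
    and "K \<in> measurable \<G> (prob_algebra borel)"
    and "(\<lambda>(S, T). ipm F (empirical n S) (empirical n T))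
           \<in> borel_measurable (Pi\<^sub>M {1..n} (\<lambda>_. borel) \<Otimes>\<^sub>M Pi\<^sub>M {1..n} (\<lambda>_. borel))"
    and "prob_space \<pi>" and "sets \<pi> = sets \<G>"
    and "lam > 0" and "0 < \<delta>" and "\<delta> < 1"
    and "prob_space \<rho>" and "sets \<rho> = sets \<G>"
    and "absolutely_continuous \<pi> \<rho>" and "absolutely_continuous \<rho> \<pi>"
  shows "\<P>(S in iid_sample n P.
            ereal ((\<integral>g. (\<integral>S'. empirical_risk F n S' (K g) \<partial>iid_sample n P) \<partial>\<rho>)
                   - (\<integral>g. empirical_risk F n S (K g) \<partial>\<rho>))
            \<le> ereal (1 / lam) * (KL \<rho> \<pi> + ereal (ln (1 / \<delta>)))
               + ereal (lam * (diameter (UNIV :: 'a set))\<^sup>2 / (4 * real n))) \<ge> 1 - \<delta>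
       \<and> \<P>((S, g) in iid_sample n P \<Otimes>\<^sub>M \<rho>.
            (\<integral>S'. empirical_risk F n S' (K g) \<partial>iid_sample n P) - empirical_risk F n S (K g)
            \<le> 1 / lam * (log_density \<rho> \<pi> g + ln (1 / \<delta>))
               + lam * (diameter (UNIV :: 'a set))\<^sup>2 / (4 * real n)) \<ge> 1 - \<delta>"
proof -
  note bdd = assms(1) and lip = assms(2) and P = assms(4) and setsP = assms(5) and n = assms(6)
    and K = assms(7) and \<pi> = assms(9) and lam = assms(11) and \<delta> = assms(12) and \<rho> = assms(14)
    and sets\<rho> = assms(15) and ac = assms(16)
  have sets: "sets \<rho> = sets \<pi>" using assms by simp
  let ?S = "iid_sample n P" and ?D = "diameter (UNIV :: 'a set)"
  define d where "d S T = ipm F (empirical n S) (empirical n T)" for S T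
  define h where "h S g = empirical_risk F n S (K g)" for S g
  define B where "B = ?D + \<bar>Sup {}\<bar>"
  have h_eq: "h S g = (\<integral>T. d S T \<partial>iid_sample n (K g))" for S g
    by (simp add: h_def d_def empirical_risk_def)
  have dB: "\<bar>d S T\<bar> \<le> B" for S T
    unfolding d_def B_def by (rule abs_ipm_empirical_le[OF bdd lip n])
  have setsS: "sets ?S = sets (Pi\<^sub>M {1..n} (\<lambda>_. borel))"
    using setsP by (intro sets_PiM_cong) auto
  have KP: "prob_space (iid_sample n (K g))"
    and Ksets: "sets (iid_sample n (K g)) = sets (Pi\<^sub>M {1..n} (\<lambda>_. borel))" if "g \<in> space \<rho>" for g
  proof -
    have "g \<in> space \<G>" using that sets_eq_imp_space_eq[OF sets\<rho>] by simp
    then have "K g \<in> space (prob_algebra borel)" using K by (rule measurable_space[rotated])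
    then show "prob_space (iid_sample n (K g))"
      "sets (iid_sample n (K g)) = sets (Pi\<^sub>M {1..n} (\<lambda>_. borel))"
      by (auto simp: space_prob_algebra intro!: prob_space_PiM sets_PiM_cong)
  qed
  have S: "prob_space ?S" using P by (intro prob_space_PiM)
  interpret S: prob_space ?S by (rule S)
  interpret \<rho>: prob_space \<rho> by (rule \<rho>)
  have d_meas: "case_prod d \<in> borel_measurable (?S \<Otimes>\<^sub>M Pi\<^sub>M {1..n} (\<lambda>_. borel))"
    using assms(8) setsS unfolding d_def by (simp cong: measurable_cong_sets sets_pair_measure_cong)
  note [measurable] = d_meas
  have K': "(\<lambda>g. iid_sample n (K g)) \<in> measurable \<rho> (prob_algebra (Pi\<^sub>M {1..n} (\<lambda>_. borel)))"
    using measurable_PiM_prob_algebra[OF finite_atLeastAtMost K] sets\<rho> by (simp cong: measurable_cong_sets)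
  \<comment> \<open>The pair of sample and generator serves as the kernel parameter: the integrand
    uses its first component, the sampling kernel its second.\<close>
  have h_meas [measurable]: "case_prod h \<in> borel_measurable (?S \<Otimes>\<^sub>M \<rho>)"
  proof -
    have "(\<lambda>p. \<integral>T. d (fst p) T \<partial>iid_sample n (K (snd p))) \<in> borel_measurable (?S \<Otimes>\<^sub>M \<rho>)"
      by (rule measurable_integral_kernel[where f = "\<lambda>p. d (fst p)" and B = B,
            OF _ measurable_compose[OF measurable_snd K'] dB]) measurable
    then show ?thesis by (simp add: h_eq case_prod_unfold)
  qed
  have hB: "\<bar>h S g\<bar> \<le> B" if "g \<in> space \<rho>" for S g
    unfolding h_eq by (intro prob_space.abs_integral_le_const[OF KP[OF that]] dB)
  have hS: "(\<lambda>S. h S g) \<in> borel_measurable ?S" if "g \<in> space \<rho>" for g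
    using that by measurable
  define m where "m g = (\<integral>S. h S g \<partial>?S)" for g
  have m_meas [measurable]: "m \<in> borel_measurable \<rho>" unfolding m_def by measurable
  have mB: "\<bar>m g\<bar> \<le> B" if "g \<in> space \<rho>" for g
    unfolding m_def by (intro S.abs_integral_le_const hB that)
  \<comment> \<open>Both risks average over the same generated sample \<open>T\<close>, so their
    difference is the average of pointwise differences of the metric.\<close>
  have h_diff: "\<bar>h (S(i := x)) g - h S g\<bar> \<le> ?D / n"
    if S: "S \<in> space ?S" and i: "i \<in> {1..n}" and x: "x \<in> space P" and g: "g \<in> space \<rho>" for S i x g
  proof -
    have S': "S(i := x) \<in> space ?S" using S i x by (auto simp: space_PiM PiE_iff extensional_def)
    have int: "integrable (iid_sample n (K g)) (d S)" if "S \<in> space ?S" for S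
    proof (rule prob_space.integrable_bounded[OF KP[OF g] _ dB])
      have "d S \<in> borel_measurable (Pi\<^sub>M {1..n} (\<lambda>_. borel))" using that by measurable
      then show "d S \<in> borel_measurable (iid_sample n (K g))"
        using Ksets[OF g] by (simp cong: measurable_cong_sets)
    qed
    have "h (S(i := x)) g - h S g = (\<integral>T. d (S(i := x)) T - d S T \<partial>iid_sample n (K g))"
      unfolding h_eq using int[OF S] int[OF S'] by simp
    also have "\<bar>\<dots>\<bar> \<le> ?D / n"
      unfolding d_def
      by (intro prob_space.abs_integral_le_const[OF KP[OF g]] ipm_empirical_bounded_differences[OF bdd lip n i])
    finally show ?thesis .
  qed
  \<comment> \<open>\<open>e\<close> is \<open>lam\<close> times the last term of the claimed
    bounds. Subtracting it normalises \<open>X\<close> so that its exponential has mean at most 1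
    over the sample.\<close>
  define e where "e = lam\<^sup>2 * ?D\<^sup>2 / (4 * real n)"
  define X where "X S g = lam * (m g - h S g) - e" for S g
  have X_meas: "case_prod X \<in> borel_measurable (?S \<Otimes>\<^sub>M \<rho>)"
    unfolding X_def by measurable
  have moment: "(\<integral>\<^sup>+S. ennreal (exp (X S g)) \<partial>?S) \<le> 1" if g: "g \<in> space \<rho>" for g
  proof -
    \<comment> \<open>The deviation is the mean minus the risk, so the bounded-differences estimate
      is applied to the negated risk.\<close>
    note [measurable] = hS[OF g]
    have "(\<integral>\<^sup>+S. ennreal (exp (X S g)) \<partial>?S)
      = (\<integral>\<^sup>+S. ennreal (exp (- e)) * ennreal (exp (lam * (- h S g - (\<integral>S'. - h S' g \<partial>?S)))) \<partial>?S)"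
      by (simp add: X_def m_def ennreal_mult[symmetric] exp_add[symmetric] algebra_simps)
    also have "\<dots> = ennreal (exp (- e)) * (\<integral>\<^sup>+S. ennreal (exp (lam * (- h S g - (\<integral>S'. - h S' g \<partial>?S)))) \<partial>?S)"
      by (intro nn_integral_cmult) measurable
    also have "\<dots> \<le> ennreal (exp (- e)) * ennreal (exp (lam\<^sup>2 * (\<Sum>i\<in>{1..n}. (?D / n)\<^sup>2) / 8))"
    proof (intro mult_left_mono bounded_differences_exp_moment[OF P _ lam])
      show "\<bar>- h S g\<bar> \<le> B" for S using hB[OF g] by simp
      show "\<bar>- h (S(i := x)) g - - h S g\<bar> \<le> ?D / n"
        if "S \<in> space ?S" "i \<in> {1..n}" "x \<in> space P" for S i x
        using h_diff[OF that g] by (simp add: abs_minus_commute)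
    qed (use hS[OF g] in auto)
    also have "\<dots> = ennreal (exp (- e + lam\<^sup>2 * ?D\<^sup>2 / (8 * n)))"
      using n by (simp add: ennreal_mult[symmetric] exp_add[symmetric] power_divide power2_eq_square)
    \<comment> \<open>The \<open>n\<close> squared differences sum to \<open>?D^2 / n\<close>, so
      the moment estimate has denominator \<open>8 * n\<close>, and \<open>e\<close> with
      denominator \<open>4 * n\<close> dominates it.\<close>
    also have "\<dots> \<le> ennreal (exp 0)"
    proof (intro ennreal_leI, subst exp_le_cancel_iff)
      have "lam\<^sup>2 * ?D\<^sup>2 / (8 * n) \<le> e" unfolding e_def using n by (intro divide_left_mono) auto
      then show "- e + lam\<^sup>2 * ?D\<^sup>2 / (8 * n) \<le> 0" by simp
    qed
    finally show ?thesis by simp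
  qed
  have e_lam: "e / lam = lam * ?D\<^sup>2 / (4 * real n)"
    using lam by (simp add: e_def power2_eq_square)
  \<comment> \<open>Multiplication by the positive \<open>lam\<close> turns the inequalities of the
    theorem into the form of the abstract bounds for \<open>X\<close>.\<close>
  have rescale: "X' \<le> 1 / lam * Y + lam * ?D\<^sup>2 / (4 * real n) \<longleftrightarrow> lam * X' - e \<le> Y" for X' Y
    unfolding e_lam[symmetric] using lam by (simp add: field_simps)
  have part2: "\<P>((S, g) in ?S \<Otimes>\<^sub>M \<rho>. m g - h S g
      \<le> 1 / lam * (log_density \<rho> \<pi> g + ln (1 / \<delta>)) + lam * ?D\<^sup>2 / (4 * real n)) \<ge> 1 - \<delta>"
    unfolding rescale X_def[symmetric]
    by (rule pac_bayes_pointwise[OF S \<pi> \<rho> sets ac X_meas moment \<delta>])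
  have XB: "\<bar>X S g\<bar> \<le> lam * (2 * B) + \<bar>e\<bar>" if "g \<in> space \<rho>" for S g
  proof -
    have "\<bar>lam * (m g - h S g)\<bar> \<le> lam * (2 * B)"
      using hB[OF that, of S] mB[OF that] lam by (simp add: abs_mult)
    then show ?thesis unfolding X_def by linarith
  qed
  have event: "ereal ((\<integral>g. m g \<partial>\<rho>) - (\<integral>g. h S g \<partial>\<rho>))
      \<le> ereal (1 / lam) * (KL \<rho> \<pi> + ereal (ln (1 / \<delta>))) + ereal (lam * ?D\<^sup>2 / (4 * real n))
    \<longleftrightarrow> ereal (\<integral>g. X S g \<partial>\<rho>) \<le> KL \<rho> \<pi> + ereal (ln (1 / \<delta>))" if "S \<in> space ?S" for S
  proof -
    have "integrable \<rho> (h S)"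
      using that hB by (intro \<rho>.integrable_bounded[where B = B]) measurable
    moreover have "integrable \<rho> m"
      using mB by (intro \<rho>.integrable_bounded[where B = B]) measurable
    ultimately have X: "(\<integral>g. X S g \<partial>\<rho>) = lam * ((\<integral>g. m g \<partial>\<rho>) - (\<integral>g. h S g \<partial>\<rho>)) - e"
      unfolding X_def by (simp add: \<rho>.prob_space)
    \<comment> \<open>For a finite right-hand side this is \<open>rescale\<close>; for an infinite
      one, scaling by a positive real and adding a real leave it unchanged, so both inequalities
      have the same truth value.\<close>
    show ?thesis
      unfolding X using lam rescale
      by (cases "KL \<rho> \<pi> + ereal (ln (1 / \<delta>))") auto
  qed
  have "\<P>(S in ?S. ereal (\<integral>g. X S g \<partial>\<rho>) \<le> KL \<rho> \<pi> + ereal (ln (1 / \<delta>))) \<ge> 1 - \<delta>"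
    by (rule pac_bayes_expectation[OF S \<pi> \<rho> sets ac X_meas moment \<delta> XB])
  then have part1: "\<P>(S in ?S. ereal ((\<integral>g. m g \<partial>\<rho>) - (\<integral>g. h S g \<partial>\<rho>))
      \<le> ereal (1 / lam) * (KL \<rho> \<pi> + ereal (ln (1 / \<delta>))) + ereal (lam * ?D\<^sup>2 / (4 * real n))) \<ge> 1 - \<delta>"
    using event by (simp cong: conj_cong)
  show ?thesis
    using part1 part2 unfolding m_def h_def by (rule conjI)
qed

end
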